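(* Let $G$ be a Hausdorff topological gyrogroup and let $\mathcal{U}$ be an open base at the identity element $e$ of $G$. Then the family $$\{f\oplus O(U,\varepsilon) : U\in\mathcal{U},\ \varepsilon>0,\ f\in G^\bullet\}$$ is a base of a topology on $G^\bullet$, and with this topology (and the pointwise operation) $G^\bullet$ is a Hausdorff topological gyrogroup.
   Context: A gyrogroup is a nonempty set $G$ with a binary operation $\oplus$ such that: (G1) there is $e\in G$ with $e\oplus x=x=x\oplus e$ for all $x$; (G2) each $x\in G$ has an inverse $\ominus x\in G$ with $\ominus x\oplus x=e=x\oplus(\ominus x)$; (G3) for all $x,y\in G$ there is an automorphism $\mathrm{gyr}[x,y]$ of $(G,\oplus)$ such that $x\oplus(y\oplus z)=(x\oplus y)\oplus\mathrm{gyr}[x,y](z)$ for all $z\in G$; (G4) $\mathrm{gyr}[x\oplus y,y]=\mathrm{gyr}[x,y]$ for all $x,y\in G$. A topological gyrogroup is a gyrogroup $G$ with a topology such that $\oplus:G\times G\to G$ (product topology on $G\times G$) and $x\mapsto\ominus x$ are continuous. An open base at $e$ is a neighborhood base at $e$ consisting of open sets. Let $J=[0,1)$. A function $f:J\to G$ is a step function if there are reals $0=a_0<a_1<\dots<a_n=1$ such that $f$ is constant on $[a_k,a_{k+1})$ for $k=0,\dots,n-1$. $G^\bullet$ denotes the set of all step functions $J\to G$ with the pointwise operation $(f\oplus g)(r)=f(r)\oplus g(r)$; it is known that $G^\bullet$ is a gyrogroup. For an open neighborhood $U$ of $e$ in $G$ and $\varepsilon>0$, put $O(U,\varepsilon)=\{f\in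 G^\bullet : \mu(\{r\in J : f(r)\notin U\})<\varepsilon\}$, where $\mu$ is Lebesgue measure; and $f\oplus O(U,\varepsilon)=\{f\oplus g : g\in O(U,\varepsilon)\}$. *)

theory Defs
  imports "HOL-Analysis.Analysis"
begin

definition gyro_id :: "'a set \<Rightarrow> ('a \<Rightarrow> 'a \<Rightarrow> 'a) \<Rightarrow> 'a"
  where "gyro_id G add = (THE e. e \<in> G \<and> (\<forall>x\<in>G. add e x = x \<and> add x e = x))"

definition gyro_inv :: "'a set \<Rightarrow> ('a \<Rightarrow> 'a \<Rightarrow> 'a) \<Rightarrow> 'a \<Rightarrow> 'a"
  where "gyro_inv G add x =
    (THE y. y \<in> G \<and> add y x = gyro_id G add \<and> add x y = gyro_id G add)"

definition gyro_aut :: "'a set \<Rightarrow> ('a \<Rightarrow> 'a \<Rightarrow> 'a) \<Rightarrow> ('a \<Rightarrow> 'a) \<Rightarrow> bool"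
  where "gyro_aut G add h \<longleftrightarrow>
    bij_betw h G G \<and> (\<forall>x\<in>G. \<forall>y\<in>G. h (add x y) = add (h x) (h y))"

text \<open>Gyrations are functions on the carrier, so their equality in the last axiom is
  equality at all points of \<open>G\<close>.\<close>

locale gyrogroup =
  fixes G :: "'a set"
    and add :: "'a \<Rightarrow> 'a \<Rightarrow> 'a" (infixl "\<oplus>" 65)
  assumes closed: "x \<in> G \<Longrightarrow> y \<in> G \<Longrightarrow> x \<oplus> y \<in> G"
    and ex_identity: "\<exists>e\<in>G. \<forall>x\<in>G. e \<oplus> x = x \<and> x \<oplus> e = x"
    and ex_inverse: "x \<in> G \<Longrightarrow> \<exists>y\<in>G. y \<oplus> x = gyro_id G (\<oplus>) \<and> x \<oplus> y = gyro_id G (\<oplus>)"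
    and ex_gyr: "\<exists>gyr.
        (\<forall>x\<in>G. \<forall>y\<in>G. gyro_aut G (\<oplus>) (gyr x y) \<and>
          (\<forall>z\<in>G. x \<oplus> (y \<oplus> z) = (x \<oplus> y) \<oplus> gyr x y z)) \<and>
        (\<forall>x\<in>G. \<forall>y\<in>G. \<forall>z\<in>G. gyr (x \<oplus> y) y z = gyr x y z)"
begin

text \<open>The definite descriptions above are well defined in every gyrogroup.\<close>

lemma gyro_id_eqI:
  assumes "e \<in> G" "\<And>x. x \<in> G \<Longrightarrow> e \<oplus> x = x \<and> x \<oplus> e = x"
  shows "gyro_id G (\<oplus>) = e"
  unfolding gyro_id_def
proof (rule the_equality)
  show "e \<in> G \<and> (\<forall>x\<in>G. e \<oplus> x = x \<and> x \<oplus> e = x)"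
    using assms by blast
  fix e' assume "e' \<in> G \<and> (\<forall>x\<in>G. e' \<oplus> x = x \<and> x \<oplus> e' = x)"
  then show "e' = e" using assms by metis
qed

lemma gyro_id: "gyro_id G (\<oplus>) \<in> G"
  and gyro_id_left: "x \<in> G \<Longrightarrow> gyro_id G (\<oplus>) \<oplus> x = x"
  and gyro_id_right: "x \<in> G \<Longrightarrow> x \<oplus> gyro_id G (\<oplus>) = x"
  using ex_identity gyro_id_eqI by metis+

lemma gyro_inv_eqI:
  assumes x: "x \<in> G" and y: "y \<in> G"
    and yx: "y \<oplus> x = gyro_id G (\<oplus>)" and xy: "x \<oplus> y = gyro_id G (\<oplus>)"
  shows "gyro_inv G (\<oplus>) x = y"
  unfolding gyro_inv_def
proof (rule the_equality)
  show "y \<in> G \<and> y \<oplus> x = gyro_id G (\<oplus>) \<and> x \<oplus> y = gyro_id G (\<oplus>)"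
    using assms by blast
  fix y' assume y': "y' \<in> G \<and> y' \<oplus> x = gyro_id G (\<oplus>) \<and> x \<oplus> y' = gyro_id G (\<oplus>)"
  obtain h where bij: "bij_betw h G G"
    and h: "\<And>z. z \<in> G \<Longrightarrow> y \<oplus> (x \<oplus> z) = (y \<oplus> x) \<oplus> h z"
    using ex_gyr x y unfolding gyro_aut_def by metis
  have hG: "h z \<in> G" if "z \<in> G" for z
    using bij that by (rule bij_betwE [rule_format])
  have "h y' = h y"
    using h[of y'] h[OF y] y y' xy yx hG gyro_id_left by metis
  then show "y' = y"
    using bij y y' by (meson bij_betw_imp_inj_on inj_onD)
qed

lemma gyro_inv:
  assumes "x \<in> G"
  shows "gyro_inv G (\<oplus>) x \<in> G"
    and "gyro_inv G (\<oplus>) x \<oplus> x = gyro_id G (\<oplus>)"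
    and "x \<oplus> gyro_inv G (\<oplus>) x = gyro_id G (\<oplus>)"
  using ex_inverse[OF assms] gyro_inv_eqI[OF assms] by metis+

end

locale topological_gyrogroup = gyrogroup G add
  for G :: "'a set" and add :: "'a \<Rightarrow> 'a \<Rightarrow> 'a" (infixl "\<oplus>" 65) +
  fixes T :: "'a topology"
  assumes topspace_eq: "topspace T = G"
    and continuous_add: "continuous_map (prod_topology T T) T (\<lambda>(x, y). x \<oplus> y)"
    and continuous_inv: "continuous_map T T (gyro_inv G (\<oplus>))"

definition open_base_at :: "'a topology \<Rightarrow> 'a \<Rightarrow> 'a set set \<Rightarrow> bool"
  where "open_base_at T p \<U> \<longleftrightarrow>
    (\<forall>U\<in>\<U>. openin T U \<and> p \<in> U) \<and>
    (\<forall>V. openin T V \<and> p \<in> V \<longrightarrow> (\<exists>U\<in>\<U>. U \<subseteq> V))"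

abbreviation unit_J :: "real set"
  where "unit_J \<equiv> {0..<1}"

text \<open>Functions on \<open>[0,1)\<close> are represented by extensional functions on the reals
  (value \<^const>\<open>undefined\<close> outside \<open>[0,1)\<close>), so that equality of representatives is
  equality of functions on \<open>[0,1)\<close>.\<close>

definition step_functions :: "'a set \<Rightarrow> (real \<Rightarrow> 'a) set"
  where "step_functions G =
    {f \<in> unit_J \<rightarrow>\<^sub>E G.
      \<exists>(n::nat) a::nat \<Rightarrow> real. a 0 = 0 \<and> a n = 1 \<and> (\<forall>k<n. a k < a (Suc k)) \<and>
        (\<forall>k<n. f constant_on {a k..<a (Suc k)})}"

definition pointwise_add :: "('a \<Rightarrow> 'a \<Rightarrow> 'a) \<Rightarrow> (real \<Rightarrow> 'a) \<Rightarrow> (real \<Rightarrow> 'a) \<Rightarrow> real \<Rightarrow> 'a"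
  where "pointwise_add add f g = (\<lambda>r\<in>unit_J. add (f r) (g r))"

definition step_nhd :: "'a set \<Rightarrow> 'a set \<Rightarrow> real \<Rightarrow> (real \<Rightarrow> 'a) set"
  where "step_nhd G U \<epsilon> =
    {f \<in> step_functions G. measure lebesgue {r \<in> unit_J. f r \<notin> U} < \<epsilon>}"

definition step_base ::
    "'a set \<Rightarrow> ('a \<Rightarrow> 'a \<Rightarrow> 'a) \<Rightarrow> 'a set set \<Rightarrow> (real \<Rightarrow> 'a) set set"
  where "step_base G add \<U> =
    {pointwise_add add f ` step_nhd G U \<epsilon> | f U \<epsilon>.
      U \<in> \<U> \<and> \<epsilon> > 0 \<and> f \<in> step_functions G}"

definition is_base_of_topology_on :: "'b set \<Rightarrow> 'b set set \<Rightarrow> bool"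
  where "is_base_of_topology_on X \<B> \<longleftrightarrow>
    istopology (arbitrary union_of (\<lambda>B. B \<in> \<B>)) \<and> \<Union>\<B> = X"

text \<open>Only meaningful when \<open>\<B>\<close> is a base of a topology: then the open sets are exactly
  the unions of subfamilies of \<open>\<B>\<close>.\<close>

definition topology_of_base :: "'b set set \<Rightarrow> 'b topology"
  where "topology_of_base \<B> = topology (arbitrary union_of (\<lambda>B. B \<in> \<B>))"

end

(* Call W open if each f in W satisfies f + O(U, eps) <= W for some U and eps. A step function
   takes only finitely many values, so every condition "phi x v is in U for all v near e", with
   phi continuous and x ranging over the values of given step functions, holds for v in one
   common neighborhood of e. Left cancellation, -x + (x + y) = y, turns membership of h in
   f + O(U, eps) into -f + h in O(U, eps). Hence openness of the translates uses
   phi (x, y) v = -x + ((x + y) + v), and continuity of the operations uses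
   -(x + y) + ((x + p) + (y + q)) and -(-x) + -(x + p); the measures of the exceptional sets add.
   Two different step functions differ on a nondegenerate interval, which yields separation. *)

theory Submission
  imports Defs
begin

section \<open>Step functions\<close>

text \<open>Induction on the number of points: either \<open>r\<close> lies below \<open>a n\<close>
  and the induction hypothesis gives the cell, or \<open>r\<close> lies in the last cell.\<close>

lemma partition_cell:
  fixes a :: "nat \<Rightarrow> 'b::linorder"
  assumes "a 0 \<le> r" "r < a n"
  obtains k where "k < n" "a k \<le> r" "r < a (Suc k)"
proof -
  have "\<exists>k<n. a k \<le> r \<and> r < a (Suc k)"
    using assms
  proof (induction n)
    case (Suc n)
    then show ?case by (cases "r < a n") (auto intro: less_SucI)
  qed auto
  then show thesis using that by blast
qed

text \<open>The form in which partitions are used below. Each cell contains its left end point, so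
  the constant on the cell can be read off there, and the cells and their values are indexed by the
  same \<open>k < n\<close>.\<close>

lemma step_functions_cells:
  assumes "f \<in> step_functions G"
  obtains n :: nat and a :: "nat \<Rightarrow> real"
  where "\<And>r. r \<in> unit_J \<Longrightarrow> \<exists>k<n. r \<in> {a k..<a (Suc k)}"
    and "\<And>k r. k < n \<Longrightarrow> r \<in> {a k..<a (Suc k)} \<Longrightarrow> f r = f (a k)"
proof -
  obtain n :: nat and a :: "nat \<Rightarrow> real" where a: "a 0 = 0" "a n = 1" "\<forall>k<n. a k < a (Suc k)"
    "\<forall>k<n. f constant_on {a k..<a (Suc k)}"
    using assms unfolding step_functions_def by blast
  show thesis
  proof
    show "\<exists>k<n. r \<in> {a k..<a (Suc k)}" if "r \<in> unit_J" for r
      using partition_cell[of a r n] a(1,2) that by (metis atLeastLessThan_iff)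
    show "f r = f (a k)" if k: "k < n" and r: "r \<in> {a k..<a (Suc k)}" for k r
    proof -
      have "a k \<in> {a k..<a (Suc k)}" using a(3) k by auto
      moreover obtain c where "\<forall>x\<in>{a k..<a (Suc k)}. f x = c"
        using a(4) k unfolding constant_on_def by blast
      ultimately show ?thesis using r by metis
    qed
  qed
qed

text \<open>Finite sets of cut points are easier to refine than ordered partitions.\<close>

lemma step_functions_iff_cuts:
  "f \<in> step_functions G \<longleftrightarrow> f \<in> unit_J \<rightarrow>\<^sub>E G \<and>
    (\<exists>P. finite P \<and> (\<forall>r\<in>unit_J. \<forall>s\<in>unit_J. (\<forall>p\<in>P. p \<le> r \<longleftrightarrow> p \<le> s) \<longrightarrow> f r = f s))"
    (is "_ \<longleftrightarrow> _ \<and> ?cuts")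
proof
  assume f: "f \<in> step_functions G"
  then obtain n a where
    cell: "\<And>r. r \<in> unit_J \<Longrightarrow> \<exists>k<n. r \<in> {a k..<a (Suc k)}" and
    const: "\<And>k r. k < n \<Longrightarrow> r \<in> {a k..<a (Suc k)} \<Longrightarrow> f r = f (a k)"
    by (rule step_functions_cells) blast
  have "f r = f s" if r: "r \<in> unit_J" and cut: "\<forall>p\<in>a ` {..n}. p \<le> r \<longleftrightarrow> p \<le> s" for r s
  proof -
    obtain k where k: "k < n" "r \<in> {a k..<a (Suc k)}" using cell[OF r] by blast
    moreover have "a k \<in> a ` {..n}" "a (Suc k) \<in> a ` {..n}" using k(1) by auto
    \<comment> \<open>Both end points of the cell are cut points, so \<open>s\<close> lies on the
      same side of each of them as \<open>r\<close>.\<close>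
    ultimately have "s \<in> {a k..<a (Suc k)}"
      using cut by (metis atLeastLessThan_iff not_le)
    then show ?thesis using const k by metis
  qed
  then have ?cuts by (intro exI[of _ "a ` {..n}"]) auto
  then show "f \<in> unit_J \<rightarrow>\<^sub>E G \<and> ?cuts" using f by (simp add: step_functions_def)
next
  assume R: "f \<in> unit_J \<rightarrow>\<^sub>E G \<and> ?cuts"
  then obtain P where P: "finite P"
    and cut: "\<And>r s. r \<in> unit_J \<Longrightarrow> s \<in> unit_J \<Longrightarrow> (\<forall>p\<in>P. p \<le> r \<longleftrightarrow> p \<le> s) \<Longrightarrow> f r = f s"
    by blast
  define Q where "Q = insert 0 (insert 1 (P \<inter> {0<..<1}))"
  define l where "l = sorted_list_of_set Q"
  \<comment> \<open>The \<open>n + 1\<close> points of the list bound \<open>n\<close>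
    cells.\<close>
  define n where "n = length l - 1"
  have "finite Q" using P by (simp add: Q_def)
  then have set_l: "set l = Q" by (simp add: l_def)
  have mono: "l ! i \<le> l ! j" if "i \<le> j" "j < length l" for i j
    using that by (simp add: l_def sorted_nth_mono)
  have smono: "l ! i < l ! j" if "i < j" "j < length l" for i j
    using that by (simp add: l_def sorted_wrt_nth_less)
  have idx: "\<exists>i<length l. l ! i = p" if "p \<in> Q" for p
    using that by (metis in_set_conv_nth set_l)
  have mem: "l ! i \<in> Q" if "i < length l" for i
    using that set_l nth_mem by blast
  have Q01: "0 \<le> q \<and> q \<le> 1" if "q \<in> Q" for q using that by (auto simp: Q_def)
  have len: "length l > 0" using idx[of 0] by (auto simp: Q_def)
  have l0: "l ! 0 = 0"
  proof -
    obtain i where "i < length l" "l ! i = 0" using idx[of 0] by (auto simp: Q_def)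
    then show ?thesis using mono[of 0 i] Q01[OF mem[OF len]] by auto
  qed
  have ln: "l ! n = 1"
  proof -
    obtain i where "i < length l" "l ! i = 1" using idx[of 1] by (auto simp: Q_def)
    moreover have "n < length l" using len by (simp add: n_def)
    ultimately show ?thesis using mono[of i n] Q01[OF mem, of n] by (auto simp: n_def)
  qed
  have const: "f constant_on {l ! k..<l ! Suc k}" if k: "k < n" for k
  proof -
    have kl: "Suc k < length l" using k by (simp add: n_def)
    have J: "r \<in> unit_J" if "r \<in> {l ! k..<l ! Suc k}" for r
      using that Q01[OF mem, of k] Q01[OF mem, of "Suc k"] kl by auto
    \<comment> \<open>No cut point lies in the interior of a cell. A point \<open>p\<close> of
      \<open>P\<close> with \<open>p \<le> r\<close> is nonpositive or equals some
      \<open>l ! j\<close>; an index \<open>j\<close> beyond \<open>k\<close> would put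
      \<open>p\<close> at or after the right end, hence after \<open>r\<close>. So \<open>p\<close>
      is at most the left end, and \<open>s\<close> lies beyond it too.\<close>
    have less: "p \<le> s" if rs: "r \<in> {l ! k..<l ! Suc k}" "s \<in> {l ! k..<l ! Suc k}"
      and p: "p \<in> P" "p \<le> r" for r s p
    proof (cases "p \<le> 0")
      case True then show ?thesis using J[OF rs(2)] by auto
    next
      case False
      then have "p \<in> Q" using p J[OF rs(1)] by (auto simp: Q_def)
      then obtain j where j: "j < length l" "l ! j = p" using idx by blast
      have "\<not> Suc k \<le> j" using mono[of "Suc k" j] j p rs by auto
      then show ?thesis using mono[of j k] j rs kl by auto
    qed
    show ?thesis unfolding constant_on_def
    proof (intro exI ballI)
      fix r assume r: "r \<in> {l ! k..<l ! Suc k}"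
      have k': "l ! k \<in> {l ! k..<l ! Suc k}" using smono[of k "Suc k"] kl by auto
      show "f r = f (l ! k)"
        using cut[OF J[OF r] J[OF k']] less[OF r k'] less[OF k' r] by blast
    qed
  qed
  have "\<forall>k<n. l ! k < l ! Suc k" using smono by (auto simp: n_def)
  then show "f \<in> step_functions G"
    unfolding step_functions_def using R l0 ln const
    by (auto intro!: exI[of _ n] exI[of _ "(!) l"])
qed

section \<open>Values and closure properties of step functions\<close>

lemma step_functions_PiE: "f \<in> step_functions G \<Longrightarrow> f \<in> unit_J \<rightarrow>\<^sub>E G"
  by (simp add: step_functions_def)

lemma step_functions_mem: "f \<in> step_functions G \<Longrightarrow> r \<in> unit_J \<Longrightarrow> f r \<in> G"
  using step_functions_PiE by (rule PiE_mem)

lemma step_functions_eqI: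
  assumes "f \<in> step_functions G" "g \<in> step_functions H" "\<And>r. r \<in> unit_J \<Longrightarrow> f r = g r"
  shows "f = g"
proof (rule extensionalityI)
  show "f \<in> extensional unit_J" "g \<in> extensional unit_J"
    using assms(1,2)[THEN step_functions_PiE] by (simp_all add: PiE_iff)
qed fact

lemma step_functions_const: "c \<in> G \<Longrightarrow> (\<lambda>r\<in>unit_J. c) \<in> step_functions G"
  unfolding step_functions_iff_cuts by auto

text \<open>The union of two cut sets refines both. Pairing lets arguments by finiteness of the
  range or by local constancy treat two step functions at once.\<close>

lemma step_functions_Pair:
  assumes "f \<in> step_functions G" "g \<in> step_functions H"
  shows "(\<lambda>r\<in>unit_J. (f r, g r)) \<in> step_functions (G \<times> H)"
proof -
  obtain P where P: "finite P"
    "\<And>r s. r \<in> unit_J \<Longrightarrow> s \<in> unit_J \<Longrightarrow> (\<forall>p\<in>P. p \<le> r \<longleftrightarrow> p \<le> s) \<Longrightarrow> f r = f s"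
    using assms(1) unfolding step_functions_iff_cuts by blast
  obtain Q where Q: "finite Q"
    "\<And>r s. r \<in> unit_J \<Longrightarrow> s \<in> unit_J \<Longrightarrow> (\<forall>p\<in>Q. p \<le> r \<longleftrightarrow> p \<le> s) \<Longrightarrow> g r = g s"
    using assms(2) unfolding step_functions_iff_cuts by blast
  have eq: "f r = f s \<and> g r = g s"
    if "r \<in> unit_J" "s \<in> unit_J" "\<forall>p\<in>P \<union> Q. p \<le> r \<longleftrightarrow> p \<le> s" for r s
    using P(2)[OF that(1,2)] Q(2)[OF that(1,2)] that(3) by blast
  show ?thesis
    unfolding step_functions_iff_cuts
  proof (intro conjI exI[of _ "P \<union> Q"] ballI impI)
    show "(\<lambda>r\<in>unit_J. (f r, g r)) \<in> unit_J \<rightarrow>\<^sub>E G \<times> H"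
      using assms[THEN step_functions_mem] by (simp add: PiE_iff)
    show "finite (P \<union> Q)" using P(1) Q(1) by simp
    show "(\<lambda>r\<in>unit_J. (f r, g r)) r = (\<lambda>r\<in>unit_J. (f r, g r)) s"
      if "r \<in> unit_J" "s \<in> unit_J" "\<forall>p\<in>P \<union> Q. p \<le> r \<longleftrightarrow> p \<le> s" for r s
      using eq[OF that] that(1,2) by simp
  qed
qed

lemma step_functions_compose:
  assumes "f \<in> step_functions G" "\<And>x. x \<in> G \<Longrightarrow> \<phi> x \<in> H"
  shows "(\<lambda>r\<in>unit_J. \<phi> (f r)) \<in> step_functions H"
proof -
  obtain P where P: "finite P"
    "\<And>r s. r \<in> unit_J \<Longrightarrow> s \<in> unit_J \<Longrightarrow> (\<forall>p\<in>P. p \<le> r \<longleftrightarrow> p \<le> s) \<Longrightarrow> f r = f s"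
    using assms(1) unfolding step_functions_iff_cuts by blast
  show ?thesis
    unfolding step_functions_iff_cuts
  proof (intro conjI exI[of _ P] ballI impI)
    show "(\<lambda>r\<in>unit_J. \<phi> (f r)) \<in> unit_J \<rightarrow>\<^sub>E H"
      using assms(2) step_functions_mem[OF assms(1)] by (simp add: PiE_iff)
    show "(\<lambda>r\<in>unit_J. \<phi> (f r)) r = (\<lambda>r\<in>unit_J. \<phi> (f r)) s"
      if "r \<in> unit_J" "s \<in> unit_J" "\<forall>p\<in>P. p \<le> r \<longleftrightarrow> p \<le> s" for r s
      using P(2)[OF that] that(1,2) by simp
  qed fact
qed

text \<open>The uncurried \<open>\<phi>\<close> is composed with the pair of \<open>f\<close> and
  \<open>g\<close>, which is a single step function.\<close>

lemma step_functions_compose2: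
  assumes "f \<in> step_functions G" "g \<in> step_functions H"
    "\<And>x y. x \<in> G \<Longrightarrow> y \<in> H \<Longrightarrow> \<phi> x y \<in> K"
  shows "(\<lambda>r\<in>unit_J. \<phi> (f r) (g r)) \<in> step_functions K"
proof -
  have "(\<lambda>r\<in>unit_J. case_prod \<phi> ((\<lambda>r\<in>unit_J. (f r, g r)) r)) \<in> step_functions K"
    by (rule step_functions_compose[OF step_functions_Pair[OF assms(1,2)]]) (use assms(3) in auto)
  then show ?thesis by (simp cong: restrict_cong)
qed

lemma step_functions_compose3:
  assumes "f \<in> step_functions G" "g \<in> step_functions H" "h \<in> step_functions K"
    "\<And>x y z. x \<in> G \<Longrightarrow> y \<in> H \<Longrightarrow> z \<in> K \<Longrightarrow> \<phi> x y z \<in> L"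
  shows "(\<lambda>r\<in>unit_J. \<phi> (f r) (g r) (h r)) \<in> step_functions L"
proof -
  have "(\<lambda>r\<in>unit_J. case_prod \<phi> ((\<lambda>r\<in>unit_J. (f r, g r)) r) (h r)) \<in> step_functions L"
    by (rule step_functions_compose2[OF step_functions_Pair[OF assms(1,2)] assms(3)])
      (use assms(4) in auto)
  then show ?thesis by (simp cong: restrict_cong)
qed

text \<open>Every value is attained at one of the finitely many left end points. This finiteness is
  what allows one neighborhood of the identity to be chosen for all values.\<close>

lemma step_functions_finite_range:
  assumes "f \<in> step_functions G"
  shows "finite (f ` unit_J)"
proof -
  obtain n a where
    cell: "\<And>r. r \<in> unit_J \<Longrightarrow> \<exists>k<n. r \<in> {a k..<a (Suc k)}" and
    const: "\<And>k r. k < n \<Longrightarrow> r \<in> {a k..<a (Suc k)} \<Longrightarrow> f r = f (a k)"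
    using assms by (rule step_functions_cells) blast
  have "f ` unit_J \<subseteq> (\<lambda>k. f (a k)) ` {..<n}"
  proof
    fix y assume "y \<in> f ` unit_J"
    then obtain r where r: "r \<in> unit_J" "y = f r" by blast
    obtain k where "k < n" "r \<in> {a k..<a (Suc k)}" using cell[OF r(1)] by blast
    then show "y \<in> (\<lambda>k. f (a k)) ` {..<n}" using const[of k r] r(2) by simp
  qed
  then show ?thesis by (rule finite_subset) simp
qed

text \<open>Cells are closed on the left and open on the right, so there is room to the right of
  \<open>r\<close> inside its cell. It supplies the nondegenerate interval on which two distinct
  step functions stay apart.\<close>

lemma step_functions_right_constant:
  assumes "f \<in> step_functions G" "r \<in> unit_J"
  obtains d where "r < d" "d \<le> 1" "\<And>s. s \<in> {r..<d} \<Longrightarrow> f s = f r"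
proof -
  obtain n a where
    cell: "\<And>r. r \<in> unit_J \<Longrightarrow> \<exists>k<n. r \<in> {a k..<a (Suc k)}" and
    const: "\<And>k r. k < n \<Longrightarrow> r \<in> {a k..<a (Suc k)} \<Longrightarrow> f r = f (a k)"
    using assms(1) by (rule step_functions_cells) blast
  obtain k where k: "k < n" "r \<in> {a k..<a (Suc k)}" using cell[OF assms(2)] by blast
  show thesis
  proof
    \<comment> \<open>\<open>step_functions_cells\<close> does not say that cells stay inside
      \<open>unit_J\<close>; the minimum with 1 ensures it for this interval.\<close>
    show "r < min 1 (a (Suc k))" "min 1 (a (Suc k)) \<le> 1" using k(2) assms(2) by auto
    show "f s = f r" if "s \<in> {r..<min 1 (a (Suc k))}" for s
      using that k(2) const[OF k(1), of s] const[OF k] by auto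
  qed
qed

section \<open>Measure of exceptional sets\<close>

lemma step_functions_lmeasurable:
  assumes "f \<in> step_functions G"
  shows "{r \<in> unit_J. f r \<notin> U} \<in> lmeasurable"
proof -
  obtain n a where
    cell: "\<And>r. r \<in> unit_J \<Longrightarrow> \<exists>k<n. r \<in> {a k..<a (Suc k)}" and
    const: "\<And>k r. k < n \<Longrightarrow> r \<in> {a k..<a (Suc k)} \<Longrightarrow> f r = f (a k)"
    using assms by (rule step_functions_cells) blast
  \<comment> \<open>Membership of the value in \<open>U\<close> is decided cell by cell, so the
    exceptional set is a finite union of intervals cut down to \<open>unit_J\<close>, whatever the
    set \<open>U\<close> is.\<close>
  have "{r \<in> unit_J. f r \<notin> U} =
    unit_J \<inter> (\<Union>k\<in>{k\<in>{..<n}. f (a k) \<notin> U}. {a k..<a (Suc k)})"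
  proof (intro subset_antisym subsetI)
    fix r assume r: "r \<in> {r \<in> unit_J. f r \<notin> U}"
    then obtain k where "k < n" "r \<in> {a k..<a (Suc k)}" using cell[of r] by blast
    then show "r \<in> unit_J \<inter> (\<Union>k\<in>{k\<in>{..<n}. f (a k) \<notin> U}. {a k..<a (Suc k)})"
      using const[of k r] r by auto
  next
    fix r assume "r \<in> unit_J \<inter> (\<Union>k\<in>{k\<in>{..<n}. f (a k) \<notin> U}. {a k..<a (Suc k)})"
    then obtain k where "k < n" "f (a k) \<notin> U" "r \<in> {a k..<a (Suc k)}" "r \<in> unit_J" by blast
    then show "r \<in> {r \<in> unit_J. f r \<notin> U}" using const[of k r] by simp
  qed
  also have "\<dots> \<in> lmeasurable"
    by (intro fmeasurable_Int_fmeasurable sets.finite_UN bounded_set_imp_lmeasurable) auto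
  finally show ?thesis .
qed

text \<open>The last assumption says that the two exceptional sets cover \<open>A\<close>, so
  subadditivity applies. \<open>A\<close> is kept general because it serves both as the exceptional
  set of a third function and, for separation, as an interval.\<close>

lemma measure_step_functions_le:
  assumes "p \<in> step_functions G" "q \<in> step_functions H" "A \<in> sets lebesgue"
    and "\<And>r. r \<in> A \<Longrightarrow> r \<in> unit_J" "\<And>r. r \<in> A \<Longrightarrow> p r \<in> U \<Longrightarrow> q r \<in> V \<Longrightarrow> False"
  shows "measure lebesgue A \<le>
    measure lebesgue {r \<in> unit_J. p r \<notin> U} + measure lebesgue {r \<in> unit_J. q r \<notin> V}"
proof -
  have m: "{r \<in> unit_J. p r \<notin> U} \<in> lmeasurable" "{r \<in> unit_J. q r \<notin> V} \<in> lmeasurable"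
    using assms step_functions_lmeasurable by blast+
  have "measure lebesgue A \<le>
      measure lebesgue ({r \<in> unit_J. p r \<notin> U} \<union> {r \<in> unit_J. q r \<notin> V})"
    using assms m by (intro measure_mono_fmeasurable) auto
  also have "\<dots> \<le>
      measure lebesgue {r \<in> unit_J. p r \<notin> U} + measure lebesgue {r \<in> unit_J. q r \<notin> V}"
    using m by (intro measure_Un_le) auto
  finally show ?thesis .
qed

text \<open>Outside the exceptional sets of \<open>p\<close> and \<open>q\<close> the value of
  \<open>h\<close> is in \<open>U\<close>; hence the bounds add.\<close>

lemma step_nhdI2:
  assumes h: "h \<in> step_functions K" and p: "p \<in> step_nhd G V \<delta>" and q: "q \<in> step_nhd H W \<delta>'"
    and "\<And>r. r \<in> unit_J \<Longrightarrow> p r \<in> V \<Longrightarrow> q r \<in> W \<Longrightarrow> h r \<in> U"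
  shows "h \<in> step_nhd K U (\<delta> + \<delta>')"
proof -
  have "measure lebesgue {r \<in> unit_J. h r \<notin> U} \<le>
    measure lebesgue {r \<in> unit_J. p r \<notin> V} + measure lebesgue {r \<in> unit_J. q r \<notin> W}"
    using assms step_functions_lmeasurable[OF h]
    by (intro measure_step_functions_le) (auto simp: step_nhd_def)
  then show ?thesis using h p q by (simp add: step_nhd_def)
qed

lemma step_nhdI1:
  assumes h: "h \<in> step_functions K" and p: "p \<in> step_nhd G V \<delta>"
    and "\<And>r. r \<in> unit_J \<Longrightarrow> p r \<in> V \<Longrightarrow> h r \<in> U"
  shows "h \<in> step_nhd K U \<delta>"
proof -
  have "measure lebesgue {r \<in> unit_J. h r \<notin> U} \<le> measure lebesgue {r \<in> unit_J. p r \<notin> V}"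
    using assms step_functions_lmeasurable[OF h] step_functions_lmeasurable[of p G V]
    by (intro measure_mono_fmeasurable) (auto simp: step_nhd_def)
  then show ?thesis using h p by (simp add: step_nhd_def)
qed

lemma step_nhd_mono:
  "U \<subseteq> V \<Longrightarrow> \<delta> \<le> \<epsilon> \<Longrightarrow> step_nhd G U \<delta> \<subseteq> step_nhd G V \<epsilon>"
  using step_nhdI1[of _ G _ G U \<delta> V] by (fastforce simp: step_nhd_def)

section \<open>The gyrogroup of step functions\<close>

context gyrogroup
begin

text \<open>Associativity gives -x + (x + z) = gyr[-x,x](z), so left addition of x is injective.
  Comparing x + y = e + (x + y) with x + gyr[e,x](y) then shows that gyr[e,x] fixes y, and the loop
  property (G4) transfers this to gyr[-x,x].\<close>

lemma left_cancel:
  assumes x: "x \<in> G" and y: "y \<in> G"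
  shows "gyro_inv G (\<oplus>) x \<oplus> (x \<oplus> y) = y"
proof -
  let ?e = "gyro_id G (\<oplus>)"
  obtain gyr where
    aut: "\<And>x y. x \<in> G \<Longrightarrow> y \<in> G \<Longrightarrow> gyro_aut G (\<oplus>) (gyr x y)" and
    assoc: "\<And>x y z. x \<in> G \<Longrightarrow> y \<in> G \<Longrightarrow> z \<in> G \<Longrightarrow> x \<oplus> (y \<oplus> z) = (x \<oplus> y) \<oplus> gyr x y z" and
    loop: "\<And>x y z. x \<in> G \<Longrightarrow> y \<in> G \<Longrightarrow> z \<in> G \<Longrightarrow> gyr (x \<oplus> y) y z = gyr x y z"
    using ex_gyr by blast
  have gyr_G: "gyr x y z \<in> G" if "x \<in> G" "y \<in> G" "z \<in> G" for x y z
    using aut[OF that(1,2)] that(3) unfolding gyro_aut_def by (meson bij_betwE)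
  have gyr: "gyro_inv G (\<oplus>) x \<oplus> (x \<oplus> z) = gyr (gyro_inv G (\<oplus>) x) x z" if "z \<in> G" for z
    using assoc[of "gyro_inv G (\<oplus>) x" x z] gyro_inv[OF x] gyr_G x that gyro_id_left by metis
  have cancel: "a = b" if "a \<in> G" "b \<in> G" "x \<oplus> a = x \<oplus> b" for a b
    using gyr[OF that(1)] gyr[OF that(2)] that aut[OF gyro_inv(1)[OF x] x]
    unfolding gyro_aut_def by (metis bij_betw_imp_inj_on inj_onD)
  have "x \<oplus> y = x \<oplus> gyr ?e x y"
    using assoc[OF gyro_id x y] closed[OF x y] gyro_id_left x by metis
  then have "gyr ?e x y = y" using cancel gyr_G gyro_id x y by metis
  \<comment> \<open>Since -x + x = e, the loop property identifies gyr[e,x] with gyr[-x,x].\<close>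
  then show ?thesis using gyr[OF y] loop[of "gyro_inv G (\<oplus>) x" x y] gyro_inv[OF x] x y by metis
qed

lemma inv_inv: "x \<in> G \<Longrightarrow> gyro_inv G (\<oplus>) (gyro_inv G (\<oplus>) x) = x"
  by (intro gyro_inv_eqI gyro_inv)

lemma left_cancel': "x \<in> G \<Longrightarrow> y \<in> G \<Longrightarrow> x \<oplus> (gyro_inv G (\<oplus>) x \<oplus> y) = y"
  using left_cancel[of "gyro_inv G (\<oplus>) x" y] gyro_inv inv_inv by simp

lemma pointwise_add_step: "f \<in> step_functions G \<Longrightarrow> g \<in> step_functions G \<Longrightarrow>
    pointwise_add (\<oplus>) f g \<in> step_functions G"
  unfolding pointwise_add_def by (rule step_functions_compose2) (auto intro: closed)

lemma const_identity_step: "(\<lambda>r\<in>unit_J. gyro_id G (\<oplus>)) \<in> step_functions G"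
  by (rule step_functions_const[OF gyro_id])

lemma pointwise_add_const_identity:
  assumes f: "f \<in> step_functions G"
  shows "pointwise_add (\<oplus>) (\<lambda>r\<in>unit_J. gyro_id G (\<oplus>)) f = f"
    and "pointwise_add (\<oplus>) f (\<lambda>r\<in>unit_J. gyro_id G (\<oplus>)) = f"
proof -
  note const_identity_step[simp] f[simp]
  show "pointwise_add (\<oplus>) (\<lambda>r\<in>unit_J. gyro_id G (\<oplus>)) f = f"
    using step_functions_mem[OF f]
    by (intro step_functions_eqI[OF pointwise_add_step f])
      (auto simp: pointwise_add_def gyro_id_left)
  show "pointwise_add (\<oplus>) f (\<lambda>r\<in>unit_J. gyro_id G (\<oplus>)) = f"
    using step_functions_mem[OF f]
    by (intro step_functions_eqI[OF pointwise_add_step f])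
      (auto simp: pointwise_add_def gyro_id_right)
qed

text \<open>Any two identities coincide, so the definite description is the constant function. It is
  evaluated before the gyrogroup axioms are established, because the inverse axiom in
  \<open>step_gyrogroup\<close> refers to it.\<close>

lemma pointwise_identity:
  "gyro_id (step_functions G) (pointwise_add (\<oplus>)) = (\<lambda>r\<in>unit_J. gyro_id G (\<oplus>))"
  unfolding gyro_id_def[of "step_functions G"]
proof (rule the_equality)
  fix E assume "E \<in> step_functions G \<and>
    (\<forall>f\<in>step_functions G. pointwise_add (\<oplus>) E f = f \<and> pointwise_add (\<oplus>) f E = f)"
  then show "E = (\<lambda>r\<in>unit_J. gyro_id G (\<oplus>))"
    using const_identity_step pointwise_add_const_identity by metis
qed (use const_identity_step pointwise_add_const_identity in blast)

text \<open>All axioms are checked pointwise. Fixing one gyration function of \<open>G\<close> makes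
  every construction depend only on the values of the given functions, so the results are again step
  functions.\<close>

lemma step_gyrogroup: "gyrogroup (step_functions G) (pointwise_add (\<oplus>))"
proof
  let ?S = "step_functions G" and ?A = "pointwise_add (\<oplus>)"
  note mem = step_functions_mem[where G = G]
  show "?A f g \<in> ?S" if "f \<in> ?S" "g \<in> ?S" for f g
    using that by (rule pointwise_add_step)
  show "\<exists>e\<in>?S. \<forall>f\<in>?S. ?A e f = f \<and> ?A f e = f"
    using const_identity_step pointwise_add_const_identity by blast
  show "\<exists>g\<in>?S. ?A g f = gyro_id ?S ?A \<and> ?A f g = gyro_id ?S ?A" if f: "f \<in> ?S" for f
  proof (intro bexI conjI)
    show "(\<lambda>r\<in>unit_J. gyro_inv G (\<oplus>) (f r)) \<in> ?S"
      using f by (rule step_functions_compose) (rule gyro_inv)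
  qed (use mem[OF f] in \<open>auto simp: pointwise_identity pointwise_add_def gyro_inv
      intro!: restrict_ext\<close>)
  obtain gyr where
    aut: "\<And>x y. x \<in> G \<Longrightarrow> y \<in> G \<Longrightarrow> gyro_aut G (\<oplus>) (gyr x y)" and
    assoc: "\<And>x y z. x \<in> G \<Longrightarrow> y \<in> G \<Longrightarrow> z \<in> G \<Longrightarrow> x \<oplus> (y \<oplus> z) = (x \<oplus> y) \<oplus> gyr x y z" and
    loop: "\<And>x y z. x \<in> G \<Longrightarrow> y \<in> G \<Longrightarrow> z \<in> G \<Longrightarrow> gyr (x \<oplus> y) y z = gyr x y z"
    using ex_gyr by blast
  have bij: "bij_betw (gyr x y) G G" if "x \<in> G" "y \<in> G" for x y
    using aut[OF that] by (simp add: gyro_aut_def)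
  have gyr_G: "gyr x y z \<in> G" if "x \<in> G" "y \<in> G" "z \<in> G" for x y z
    using bij that by (meson bij_betwE)
  \<comment> \<open>The gyration of \<open>f\<close> and \<open>g\<close> acts at \<open>r\<close>
    as gyr[f r, g r].\<close>
  define Gyr where "Gyr f g h = (\<lambda>r\<in>unit_J. gyr (f r) (g r) (h r))" for f g h
  have Gyr_S: "Gyr f g h \<in> ?S" if "f \<in> ?S" "g \<in> ?S" "h \<in> ?S" for f g h
    unfolding Gyr_def using that by (rule step_functions_compose3) (rule gyr_G)
  have "gyro_aut ?S ?A (Gyr f g)" if f: "f \<in> ?S" and g: "g \<in> ?S" for f g
    unfolding gyro_aut_def
  proof (intro conjI ballI)
    show "bij_betw (Gyr f g) ?S ?S"
    proof (rule bij_betwI)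
      \<comment> \<open>The inverse is also taken pointwise. It is a function of the three values at
        \<open>r\<close>, hence preserves step functions, which yields surjectivity.\<close>
      let ?inv = "\<lambda>h. \<lambda>r\<in>unit_J. inv_into G (gyr (f r) (g r)) (h r)"
      show "Gyr f g \<in> ?S \<rightarrow> ?S" using Gyr_S f g by blast
      have inv_G: "inv_into G (gyr x y) z \<in> G" if "x \<in> G" "y \<in> G" "z \<in> G" for x y z
        using bij[OF that(1,2)] that(3) by (metis bij_betw_def inv_into_into)
      show inv_S: "?inv \<in> ?S \<rightarrow> ?S"
        using step_functions_compose3[where \<phi> = "\<lambda>x y. inv_into G (gyr x y)", OF f g] inv_G
        by blast
      show "?inv (Gyr f g h) = h" if h: "h \<in> ?S" for h
        using bij[OF mem[OF f] mem[OF g]] mem[OF h]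
        by (intro step_functions_eqI[OF funcset_mem[OF inv_S] h] Gyr_S f g h)
          (auto simp: Gyr_def bij_betw_def)
      show "Gyr f g (?inv h) = h" if h: "h \<in> ?S" for h
        using bij[OF mem[OF f] mem[OF g]] mem[OF h]
        by (intro step_functions_eqI[OF Gyr_S h] funcset_mem[OF inv_S] f g h)
          (auto simp: Gyr_def bij_betw_def f_inv_into_f)
    qed
    show "Gyr f g (?A h k) = ?A (Gyr f g h) (Gyr f g k)" if "h \<in> ?S" "k \<in> ?S" for h k
      unfolding Gyr_def pointwise_add_def
      using aut[OF mem[OF f] mem[OF g]] mem[OF that(1)] mem[OF that(2)]
      by (intro restrict_ext) (simp add: gyro_aut_def)
  qed
  moreover have "?A f (?A g h) = ?A (?A f g) (Gyr f g h)" "Gyr (?A f g) g h = Gyr f g h"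
    if "f \<in> ?S" "g \<in> ?S" "h \<in> ?S" for f g h
    unfolding Gyr_def pointwise_add_def
    using mem[OF that(1)] mem[OF that(2)] mem[OF that(3)]
    by (auto simp: assoc loop intro!: restrict_ext)
  ultimately show "\<exists>gyr.
      (\<forall>x\<in>?S. \<forall>y\<in>?S. gyro_aut ?S ?A (gyr x y) \<and>
        (\<forall>z\<in>?S. ?A x (?A y z) = ?A (?A x y) (gyr x y z))) \<and>
      (\<forall>x\<in>?S. \<forall>y\<in>?S. \<forall>z\<in>?S. gyr (?A x y) y z = gyr x y z)"
    by (intro exI[of _ Gyr]) simp
qed

lemma pointwise_inverse:
  assumes f: "f \<in> step_functions G"
  shows "gyro_inv (step_functions G) (pointwise_add (\<oplus>)) f =
    (\<lambda>r\<in>unit_J. gyro_inv G (\<oplus>) (f r))"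
proof (rule gyrogroup.gyro_inv_eqI[OF step_gyrogroup f])
  show "(\<lambda>r\<in>unit_J. gyro_inv G (\<oplus>) (f r)) \<in> step_functions G"
    using f by (rule step_functions_compose) (rule gyro_inv)
qed (use step_functions_mem[OF f] in \<open>auto simp: pointwise_identity pointwise_add_def gyro_inv
      intro!: restrict_ext\<close>)

text \<open>By left cancellation, the required element of the neighborhood is
  \<open>\<ominus>f \<oplus> h\<close>.\<close>

lemma mem_translate_step_nhdI:
  assumes f: "f \<in> step_functions G" and h: "h \<in> step_functions G"
    and "(\<lambda>r\<in>unit_J. gyro_inv G (\<oplus>) (f r) \<oplus> h r) \<in> step_nhd G U \<epsilon>"
  shows "h \<in> pointwise_add (\<oplus>) f ` step_nhd G U \<epsilon>"
proof (rule image_eqI[OF _ assms(3)])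
  show "h = pointwise_add (\<oplus>) f (\<lambda>r\<in>unit_J. gyro_inv G (\<oplus>) (f r) \<oplus> h r)"
    using assms(3) step_functions_mem[OF f] step_functions_mem[OF h]
    by (intro step_functions_eqI[OF h pointwise_add_step[OF f]])
      (auto simp: step_nhd_def pointwise_add_def left_cancel')
qed

lemma left_quotient_step:
  "f \<in> step_functions G \<Longrightarrow> h \<in> step_functions G \<Longrightarrow>
    (\<lambda>r\<in>unit_J. gyro_inv G (\<oplus>) (f r) \<oplus> h r) \<in> step_functions G"
  by (rule step_functions_compose2[where G = G and H = G]) (auto intro: closed gyro_inv)

end

section \<open>The topology of step functions\<close>

context topological_gyrogroup
begin

lemma continuous_map_gyro_add:
  assumes "continuous_map X T f" "continuous_map X T g"
  shows "continuous_map X T (\<lambda>x. f x \<oplus> g x)"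
  using continuous_map_compose[OF continuous_map_pairedI[OF assms] continuous_add]
  by (simp add: o_def)

lemma continuous_map_gyro_inv:
  "continuous_map X T f \<Longrightarrow> continuous_map X T (\<lambda>x. gyro_inv G (\<oplus>) (f x))"
  using continuous_map_compose[OF _ continuous_inv] by (simp add: o_def)

lemma continuous_map_gyro_const: "c \<in> G \<Longrightarrow> continuous_map X T (\<lambda>x. c)"
  by (simp add: topspace_eq)

lemmas continuous_map_gyro =
  continuous_map_gyro_add continuous_map_gyro_inv continuous_map_gyro_const

end

locale based_topological_gyrogroup = topological_gyrogroup +
  fixes \<U> :: "'a set set"
  assumes open_base: "open_base_at T (gyro_id G (\<oplus>)) \<U>"
begin

abbreviation "e \<equiv> gyro_id G (\<oplus>)"
abbreviation "inverse_of \<equiv> gyro_inv G (\<oplus>)"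
abbreviation "S \<equiv> step_functions G"
abbreviation "padd \<equiv> pointwise_add (\<oplus>)"
abbreviation "nhd \<equiv> step_nhd G"

section \<open>Common neighborhoods of the identity\<close>

lemma base_nhd:
  assumes "U \<in> \<U>"
  shows "openin T U" "e \<in> U" "U \<subseteq> G"
  using assms open_base openin_subset topspace_eq unfolding open_base_at_def by blast+

lemma ex_base_subset:
  assumes "finite X" "\<And>x. x \<in> X \<Longrightarrow> openin T (V x)" "\<And>x. x \<in> X \<Longrightarrow> e \<in> V x"
  obtains U where "U \<in> \<U>" "\<And>x. x \<in> X \<Longrightarrow> U \<subseteq> V x"
proof -
  \<comment> \<open>Intersecting with the whole space covers the case of an empty family, whose bare
    intersection would be the whole type.\<close>
  have "openin T (topspace T \<inter> (\<Inter>x\<in>X. V x))" "e \<in> topspace T \<inter> (\<Inter>x\<in>X. V x)"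
    using assms gyro_id topspace_eq
    by (auto intro: openin_Int_Inter)
  then obtain U where "U \<in> \<U>" "U \<subseteq> topspace T \<inter> (\<Inter>x\<in>X. V x)"
    using open_base unfolding open_base_at_def by blast
  then show thesis using that by blast
qed

text \<open>Each preimage of \<open>U\<close> under \<open>\<phi> x\<close> is an open neighborhood
  of \<open>e\<close>, and the finite range of \<open>f\<close> leaves only finitely many of them to
  intersect. The set \<open>Y\<close> singles out the values at which \<open>\<phi> x e\<close> is
  known to lie in \<open>U\<close>.\<close>

lemma uniform_nhd:
  assumes f: "f \<in> step_functions X" and U: "openin T U"
    and cont: "\<And>x. x \<in> X \<Longrightarrow> continuous_map T T (\<phi> x)"
    and e: "\<And>x. x \<in> f ` unit_J \<Longrightarrow> x \<in> Y \<Longrightarrow> \<phi> x e \<in> U"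
  obtains V where "V \<in> \<U>" "\<And>r v. r \<in> unit_J \<Longrightarrow> f r \<in> Y \<Longrightarrow> v \<in> V \<Longrightarrow> \<phi> (f r) v \<in> U"
proof -
  have "\<exists>V\<in>\<U>. \<forall>x\<in>f ` unit_J \<inter> Y. V \<subseteq> {v \<in> topspace T. \<phi> x v \<in> U}"
  proof (rule ex_base_subset)
    show "finite (f ` unit_J \<inter> Y)" using step_functions_finite_range[OF f] by blast
    show "openin T {v \<in> topspace T. \<phi> x v \<in> U}" if "x \<in> f ` unit_J \<inter> Y" for x
      using cont step_functions_mem[OF f] that U
      by (intro openin_continuous_map_preimage[where Y = T]) auto
    show "e \<in> {v \<in> topspace T. \<phi> x v \<in> U}" if "x \<in> f ` unit_J \<inter> Y" for x
      using e that gyro_id topspace_eq by auto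
  qed blast
  then show thesis using that by blast
qed

lemma const_e_nhd:
  assumes "U \<in> \<U>" "\<epsilon> > 0"
  shows "(\<lambda>r\<in>unit_J. e) \<in> nhd U \<epsilon>"
proof -
  have empty: "{r \<in> unit_J. (\<lambda>r\<in>unit_J. e) r \<notin> U} = {}" using base_nhd[OF assms(1)] by auto
  show ?thesis
    unfolding step_nhd_def mem_Collect_eq empty using assms(2) const_identity_step by simp
qed

section \<open>Openness of translates and the generated topology\<close>

lemma translate_mem:
  assumes "f \<in> S" "U \<in> \<U>" "\<epsilon> > 0"
  shows "f \<in> padd f ` nhd U \<epsilon>"
proof (rule mem_translate_step_nhdI[OF assms(1,1)])
  have "(\<lambda>r\<in>unit_J. inverse_of (f r) \<oplus> f r) = (\<lambda>r\<in>unit_J. e)"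
    using step_functions_mem[OF assms(1)] by (auto simp: gyro_inv intro!: restrict_ext)
  then show "(\<lambda>r\<in>unit_J. inverse_of (f r) \<oplus> f r) \<in> nhd U \<epsilon>"
    using const_e_nhd[OF assms(2,3)] by simp
qed

lemma translate_subset:
  assumes "f \<in> S"
  shows "padd f ` nhd U \<epsilon> \<subseteq> S"
  using pointwise_add_step[OF assms] by (auto simp: step_nhd_def)

text \<open>Describes the topology by neighborhoods of points, which is easier to verify than unions
  of base members; \<open>union_of_step_base_iff\<close> shows that both descriptions agree.\<close>

definition nhd_open :: "(real \<Rightarrow> 'a) set \<Rightarrow> bool"
  where "nhd_open W \<longleftrightarrow> W \<subseteq> S \<and> (\<forall>f\<in>W. \<exists>U\<in>\<U>. \<exists>\<epsilon>>0. padd f ` nhd U \<epsilon> \<subseteq> W)"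

text \<open>The strict bound on the exceptional set of \<open>g\<close> leaves a positive slack,
  which a small perturbation of \<open>h\<close> may use up. At points where \<open>g r\<close> lies
  in \<open>U\<close>, a small enough perturbing value keeps the left quotient by \<open>f\<close>
  in \<open>U\<close>.\<close>

lemma nhd_open_translate:
  assumes f: "f \<in> S" and U: "U \<in> \<U>"
  shows "nhd_open (padd f ` nhd U \<epsilon>)"
  unfolding nhd_open_def
proof (intro conjI ballI translate_subset f)
  fix h assume "h \<in> padd f ` nhd U \<epsilon>"
  then obtain g where g: "g \<in> nhd U \<epsilon>" and h: "h = padd f g" by blast
  then have gS: "g \<in> S" by (simp add: step_nhd_def)
  let ?P = "\<lambda>r\<in>unit_J. (f r, g r)"
  have P: "?P \<in> step_functions (G \<times> G)" by (rule step_functions_Pair[OF f gS])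
  \<comment> \<open>At v = e the expression reduces to y by left cancellation, so the condition
    holds exactly on pairs whose second component is in \<open>U\<close>; hence the restriction to
    \<open>G \<times> U\<close>.\<close>
  obtain V where V: "V \<in> \<U>" "\<And>r v. r \<in> unit_J \<Longrightarrow> ?P r \<in> G \<times> U \<Longrightarrow> v \<in> V \<Longrightarrow>
      (case ?P r of (x, y) \<Rightarrow> \<lambda>v. inverse_of x \<oplus> ((x \<oplus> y) \<oplus> v)) v \<in> U"
  proof (rule uniform_nhd[OF P, where U = U and Y = "G \<times> U"
        and \<phi> = "\<lambda>(x, y) v. inverse_of x \<oplus> ((x \<oplus> y) \<oplus> v)"])
    show "continuous_map T T (case z of (x, y) \<Rightarrow> \<lambda>v. inverse_of x \<oplus> ((x \<oplus> y) \<oplus> v))"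
      if "z \<in> G \<times> G" for z
      using that by (auto intro!: continuous_map_gyro closed gyro_inv continuous_map_id[unfolded id_def])
    show "(case z of (x, y) \<Rightarrow> \<lambda>v. inverse_of x \<oplus> ((x \<oplus> y) \<oplus> v)) e \<in> U"
      if "z \<in> G \<times> U" for z
      using that base_nhd[OF U] by (auto simp: gyro_id_right closed left_cancel subset_iff)
  qed (use base_nhd[OF U] in auto)
  \<comment> \<open>The measure still available to the perturbation.\<close>
  define \<delta> where "\<delta> = \<epsilon> - measure lebesgue {r \<in> unit_J. g r \<notin> U}"
  have "padd h ` nhd V \<delta> \<subseteq> padd f ` nhd U \<epsilon>"
  proof
    fix k assume "k \<in> padd h ` nhd V \<delta>"
    then obtain q where q: "q \<in> nhd V \<delta>" and k: "k = padd h q" by blast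
    have qS: "q \<in> S" using q by (simp add: step_nhd_def)
    have hS: "h \<in> S" using h f gS pointwise_add_step by blast
    have kS: "k \<in> S" using k hS qS pointwise_add_step by blast
    let ?d = "\<lambda>r\<in>unit_J. inverse_of (f r) \<oplus> k r"
    have dS: "?d \<in> S" by (rule left_quotient_step[OF f kS])
    have "measure lebesgue {r \<in> unit_J. ?d r \<notin> U} \<le>
      measure lebesgue {r \<in> unit_J. g r \<notin> U} + measure lebesgue {r \<in> unit_J. q r \<notin> V}"
    proof (rule measure_step_functions_le[OF gS qS])
      show "{r \<in> unit_J. ?d r \<notin> U} \<in> sets lebesgue"
        using step_functions_lmeasurable[OF dS] by blast
      fix r assume "r \<in> {r \<in> unit_J. ?d r \<notin> U}" "g r \<in> U" "q r \<in> V"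
      then show False
        using V(2)[of r "q r"] step_functions_mem[OF f]
        by (auto simp: h k pointwise_add_def)
    qed auto
    then show "k \<in> padd f ` nhd U \<epsilon>"
      using q dS by (intro mem_translate_step_nhdI f kS) (simp add: step_nhd_def \<delta>_def)
  qed
  moreover have "\<delta> > 0" using g by (simp add: step_nhd_def \<delta>_def)
  ultimately show "\<exists>V\<in>\<U>. \<exists>\<delta>>0. padd h ` nhd V \<delta> \<subseteq> padd f ` nhd U \<epsilon>" using V(1) by blast
qed

lemma nhd_openD:
  assumes "nhd_open W"
  shows "W \<subseteq> S" and "f \<in> W \<Longrightarrow> \<exists>U\<in>\<U>. \<exists>\<epsilon>>0. padd f ` nhd U \<epsilon> \<subseteq> W"
  using assms by (simp_all add: nhd_open_def)

lemma nhd_open_Union: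
  assumes "\<And>B. B \<in> \<W> \<Longrightarrow> nhd_open B"
  shows "nhd_open (\<Union>\<W>)"
  unfolding nhd_open_def
proof (intro conjI ballI)
  show "\<Union>\<W> \<subseteq> S" using assms by (auto simp: nhd_open_def)
  fix f assume "f \<in> \<Union>\<W>"
  then obtain B where "B \<in> \<W>" "f \<in> B" by blast
  then obtain U \<epsilon> where "U \<in> \<U>" "\<epsilon> > 0" "padd f ` nhd U \<epsilon> \<subseteq> B"
    using assms unfolding nhd_open_def by blast
  then show "\<exists>U\<in>\<U>. \<exists>\<epsilon>>0. padd f ` nhd U \<epsilon> \<subseteq> \<Union>\<W>" using \<open>B \<in> \<W>\<close> by blast
qed

text \<open>Base members are themselves \<open>nhd_open\<close>, and so are their unions.
  Conversely, every point of a \<open>nhd_open\<close> set lies in its own translate, so the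
  translates contained in the set cover it.\<close>

lemma union_of_step_base_iff:
  "(arbitrary union_of (\<lambda>B. B \<in> step_base G (\<oplus>) \<U>)) W \<longleftrightarrow> nhd_open W"
proof
  assume "(arbitrary union_of (\<lambda>B. B \<in> step_base G (\<oplus>) \<U>)) W"
  then obtain \<W> where W: "\<W> \<subseteq> step_base G (\<oplus>) \<U>" "\<Union>\<W> = W"
    unfolding union_of_def arbitrary_def by blast
  have "nhd_open B" if "B \<in> \<W>" for B
    using that W(1) nhd_open_translate unfolding step_base_def by blast
  then show "nhd_open W" using W(2) nhd_open_Union by blast
next
  assume W: "nhd_open W"
  have "\<exists>B. B \<in> step_base G (\<oplus>) \<U> \<and> f \<in> B \<and> B \<subseteq> W" if f: "f \<in> W" for f
  proof -
    obtain U \<epsilon> where U: "U \<in> \<U>" "\<epsilon> > 0" "padd f ` nhd U \<epsilon> \<subseteq> W"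
      using nhd_openD(2)[OF W f] by blast
    moreover have "f \<in> S" using nhd_openD(1)[OF W] f by blast
    ultimately have "padd f ` nhd U \<epsilon> \<in> step_base G (\<oplus>) \<U>" unfolding step_base_def by blast
    then show ?thesis using U translate_mem \<open>f \<in> S\<close> by blast
  qed
  then show "(arbitrary union_of (\<lambda>B. B \<in> step_base G (\<oplus>) \<U>)) W"
    by (simp add: arbitrary_union_of_alt)
qed

lemma istopology_nhd_open: "istopology nhd_open"
  unfolding istopology_def
proof (intro conjI allI impI)
  fix V W assume V: "nhd_open V" and W: "nhd_open W"
  show "nhd_open (V \<inter> W)"
    unfolding nhd_open_def
  proof (intro conjI ballI)
    show "V \<inter> W \<subseteq> S" using V by (auto simp: nhd_open_def)
    fix f assume "f \<in> V \<inter> W"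
    then obtain A \<alpha> B \<beta> where AB: "A \<in> \<U>" "\<alpha> > 0" "padd f ` nhd A \<alpha> \<subseteq> V"
      "B \<in> \<U>" "\<beta> > 0" "padd f ` nhd B \<beta> \<subseteq> W"
      using nhd_openD(2)[OF V, of f] nhd_openD(2)[OF W, of f] by blast
    \<comment> \<open>A base member inside both \<open>A\<close> and \<open>B\<close>, with the
      smaller radius, serves both translates by \<open>step_nhd_mono\<close>.\<close>
    obtain C where C: "C \<in> \<U>" "\<And>x. x \<in> {A, B} \<Longrightarrow> C \<subseteq> x"
      using ex_base_subset[of "{A, B}" "\<lambda>x. x"] base_nhd AB(1,4) by auto
    have "nhd C (min \<alpha> \<beta>) \<subseteq> nhd A \<alpha>" "nhd C (min \<alpha> \<beta>) \<subseteq> nhd B \<beta>"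
      using C(2) by (intro step_nhd_mono; simp)+
    then show "\<exists>U\<in>\<U>. \<exists>\<epsilon>>0. padd f ` nhd U \<epsilon> \<subseteq> V \<inter> W"
      using AB C(1) by (intro bexI[of _ C] exI[of _ "min \<alpha> \<beta>"] conjI) (simp, blast)
  qed
next
  fix \<K> assume "\<forall>K\<in>\<K>. nhd_open K"
  then show "nhd_open (\<Union>\<K>)" using nhd_open_Union by blast
qed

abbreviation "TS \<equiv> topology_of_base (step_base G (\<oplus>) \<U>)"

lemma step_base_union_of_eq: "arbitrary union_of (\<lambda>B. B \<in> step_base G (\<oplus>) \<U>) = nhd_open"
  by (intro ext) (rule union_of_step_base_iff)

lemma openin_TS: "openin TS W \<longleftrightarrow> nhd_open W"
  unfolding topology_of_base_def step_base_union_of_eq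
  using istopology_nhd_open by (simp add: topology_inverse')

lemma nhd_open_S: "nhd_open S"
proof -
  \<comment> \<open>The empty family of conditions still yields a member of the base at
    \<open>e\<close>.\<close>
  obtain U where "U \<in> \<U>" using ex_base_subset[of "{}"] by auto
  then show ?thesis using translate_subset unfolding nhd_open_def by (metis order_refl zero_less_one)
qed

lemma topspace_TS: "topspace TS = S"
  using nhd_open_S openin_TS by (metis nhd_open_def openin_subset openin_topspace subset_antisym)

lemma step_base_is_base: "is_base_of_topology_on S (step_base G (\<oplus>) \<U>)"
proof -
  have "\<Union>(step_base G (\<oplus>) \<U>) \<subseteq> S" using translate_subset unfolding step_base_def by blast
  \<comment> \<open>The whole set is \<open>nhd_open\<close>, hence a union of base members.\<close>
  moreover have "S \<subseteq> \<Union>(step_base G (\<oplus>) \<U>)"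
    using nhd_open_S unfolding union_of_step_base_iff[symmetric] union_of_def by blast
  ultimately show ?thesis
    using istopology_nhd_open by (simp add: is_base_of_topology_on_def step_base_union_of_eq)
qed

section \<open>Continuity of the operations on step functions\<close>

lemma openin_translate:
  "f \<in> S \<Longrightarrow> U \<in> \<U> \<Longrightarrow> openin TS (padd f ` nhd U \<epsilon>)"
  by (simp add: openin_TS nhd_open_translate)

text \<open>The left quotient of the perturbed sum by f + g is jointly continuous in the two
  perturbations and equals \<open>e\<close> when both are \<open>e\<close>. One \<open>V\<close>
  works for the finitely many pairs of values and for every \<open>\<delta>\<close>; the exceptional
  sets of the two perturbations add up.\<close>

lemma ex_nhd_add:
  assumes f: "f \<in> S" and g: "g \<in> S" and U: "U \<in> \<U>"
  obtains V where "V \<in> \<U>"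
    "\<And>h k \<delta>. h \<in> padd f ` nhd V \<delta> \<Longrightarrow> k \<in> padd g ` nhd V \<delta> \<Longrightarrow>
      padd h k \<in> padd (padd f g) ` nhd U (\<delta> + \<delta>)"
proof -
  \<comment> \<open>With h = f + p and k = g + q, this is the value of -(f + g) + (h + k) in terms
    of the values of f, g, p and q.\<close>
  let ?F = "\<lambda>(x, y) (p, q). inverse_of (x \<oplus> y) \<oplus> ((x \<oplus> p) \<oplus> (y \<oplus> q))"
  let ?P = "\<lambda>r\<in>unit_J. (f r, g r)"
  have P: "?P \<in> step_functions (G \<times> G)" by (rule step_functions_Pair[OF f g])
  have "\<exists>A. openin T A \<and> e \<in> A \<and> (\<forall>p\<in>A. \<forall>q\<in>A. ?F z (p, q) \<in> U)" if z: "z \<in> G \<times> G" for z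
  proof -
    obtain x y where xy: "z = (x, y)" "x \<in> G" "y \<in> G" using z by blast
    have "continuous_map (prod_topology T T) T
        (\<lambda>w. inverse_of (x \<oplus> y) \<oplus> ((x \<oplus> fst w) \<oplus> (y \<oplus> snd w)))"
      using xy by (intro continuous_map_gyro closed gyro_inv continuous_map_fst continuous_map_snd)
    then have "openin (prod_topology T T) {w \<in> topspace (prod_topology T T).
        inverse_of (x \<oplus> y) \<oplus> ((x \<oplus> fst w) \<oplus> (y \<oplus> snd w)) \<in> U}" (is "openin _ ?W")
      using base_nhd[OF U] by (intro openin_continuous_map_preimage)
    moreover have "(e, e) \<in> ?W"
      using xy base_nhd[OF U] gyro_id by (simp add: topspace_eq gyro_id_right closed gyro_inv)
    ultimately obtain A B where AB: "openin T A" "openin T B" "e \<in> A" "e \<in> B" "A \<times> B \<subseteq> ?W"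
      unfolding openin_prod_topology_alt by meson
    \<comment> \<open>Intersecting the sides of the box gives one neighborhood for both
      perturbations.\<close>
    then have "?F z (p, q) \<in> U" if "p \<in> A \<inter> B" "q \<in> A \<inter> B" for p q
      using that xy by auto
    then show ?thesis using AB by (intro exI[of _ "A \<inter> B"]) auto
  qed
  then have "\<forall>z\<in>G \<times> G. \<exists>A. openin T A \<and> e \<in> A \<and> (\<forall>p\<in>A. \<forall>q\<in>A. ?F z (p, q) \<in> U)" by blast
  \<comment> \<open>Choosing a neighborhood for each pair of values prepares the intersection over
    the finite range of \<open>?P\<close>.\<close>
  from bchoice[OF this] obtain A where
    A: "\<forall>z\<in>G \<times> G. openin T (A z) \<and> e \<in> A z \<and> (\<forall>p\<in>A z. \<forall>q\<in>A z. ?F z (p, q) \<in> U)" ..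
  have rng: "z \<in> G \<times> G" if "z \<in> ?P ` unit_J" for z
    using step_functions_mem[OF P] that by blast
  obtain V where V: "V \<in> \<U>" "\<And>z. z \<in> ?P ` unit_J \<Longrightarrow> V \<subseteq> A z"
  proof (rule ex_base_subset[OF step_functions_finite_range[OF P], of A])
    show "openin T (A z)" "e \<in> A z" if "z \<in> ?P ` unit_J" for z
      using A rng[OF that] by blast+
  qed blast
  show thesis
  proof
    show "V \<in> \<U>" by fact
    fix h k \<delta> assume "h \<in> padd f ` nhd V \<delta>" "k \<in> padd g ` nhd V \<delta>"
    then obtain p q where pq: "p \<in> nhd V \<delta>" "q \<in> nhd V \<delta>" and h: "h = padd f p" and k: "k = padd g q"
      by blast
    then have pqS: "p \<in> S" "q \<in> S" by (auto simp: step_nhd_def)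
    have S: "padd f g \<in> S" "padd h k \<in> S" using f g pqS h k pointwise_add_step by auto
    have *: "inverse_of (padd f g r) \<oplus> padd h k r \<in> U" if "r \<in> unit_J" "p r \<in> V" "q r \<in> V" for r
    proof -
      have "V \<subseteq> A (f r, g r)" using V(2)[of "?P r"] that(1) by auto
      then show ?thesis
        using bspec[OF A, of "(f r, g r)"] that step_functions_mem[OF f that(1)]
          step_functions_mem[OF g that(1)]
        by (auto simp: h k pointwise_add_def)
    qed
    show "padd h k \<in> padd (padd f g) ` nhd U (\<delta> + \<delta>)"
      using * by (intro mem_translate_step_nhdI S step_nhdI2[OF left_quotient_step[OF S] pq]) simp
  qed
qed

lemma continuous_padd: "continuous_map (prod_topology TS TS) TS (\<lambda>(f, g). padd f g)"
  unfolding continuous_map_def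
proof (intro conjI allI impI)
  show "(\<lambda>(f, g). padd f g) \<in> topspace (prod_topology TS TS) \<rightarrow> topspace TS"
    using pointwise_add_step by (auto simp: topspace_TS)
  fix W assume "openin TS W"
  then have W: "nhd_open W" by (simp add: openin_TS)
  show "openin (prod_topology TS TS)
      {z \<in> topspace (prod_topology TS TS). (case z of (f, g) \<Rightarrow> padd f g) \<in> W}" (is "openin _ ?W")
    unfolding openin_prod_topology_alt
  proof (intro allI impI)
    fix f g assume "(f, g) \<in> ?W"
    then have fg: "f \<in> S" "g \<in> S" "padd f g \<in> W" by (auto simp: topspace_TS)
    then obtain U \<epsilon> where U: "U \<in> \<U>" "\<epsilon> > 0" "padd (padd f g) ` nhd U \<epsilon> \<subseteq> W"
      using W unfolding nhd_open_def by blast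
    obtain V where V: "V \<in> \<U>"
      "\<And>h k \<delta>. h \<in> padd f ` nhd V \<delta> \<Longrightarrow> k \<in> padd g ` nhd V \<delta> \<Longrightarrow>
        padd h k \<in> padd (padd f g) ` nhd U (\<delta> + \<delta>)"
      using ex_nhd_add[OF fg(1,2) U(1)] by blast
    \<comment> \<open>Each factor contributes half of the permitted measure.\<close>
    have "padd f ` nhd V (\<epsilon>/2) \<times> padd g ` nhd V (\<epsilon>/2) \<subseteq> ?W"
    proof (intro subsetI, elim SigmaE, hypsubst)
      fix h k assume hk: "h \<in> padd f ` nhd V (\<epsilon>/2)" "k \<in> padd g ` nhd V (\<epsilon>/2)"
      then have "padd h k \<in> W" using V(2)[OF hk] U(3) by auto
      moreover have "h \<in> S" "k \<in> S" using hk fg translate_subset by blast+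
      ultimately show "(h, k) \<in> ?W" by (simp add: topspace_TS)
    qed
    then show "\<exists>A B. openin TS A \<and> openin TS B \<and> f \<in> A \<and> g \<in> B \<and> A \<times> B \<subseteq> ?W"
      using openin_translate translate_mem fg V(1) U(2) by (meson half_gt_zero)
  qed
qed

text \<open>For h = f + p the left quotient of -h by -f has the values -(-x) + -(x + v), which is
  \<open>e\<close> at v = e. Only the exceptional set of \<open>p\<close> enters, so the same
  \<open>\<epsilon>\<close> can be kept.\<close>

lemma continuous_pinv: "continuous_map TS TS (gyro_inv S padd)"
  unfolding continuous_map_def
proof (intro conjI allI impI)
  note inv_S = gyrogroup.gyro_inv(1)[OF step_gyrogroup]
  show "gyro_inv S padd \<in> topspace TS \<rightarrow> topspace TS"
    using inv_S by (auto simp: topspace_TS)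
  fix W assume "openin TS W"
  then have W: "nhd_open W" by (simp add: openin_TS)
  show "openin TS {f \<in> topspace TS. gyro_inv S padd f \<in> W}"
    unfolding openin_TS topspace_TS nhd_open_def
  proof (intro conjI ballI)
    fix f assume "f \<in> {f \<in> S. gyro_inv S padd f \<in> W}"
    then have f: "f \<in> S" "gyro_inv S padd f \<in> W" by auto
    then obtain U \<epsilon> where U: "U \<in> \<U>" "\<epsilon> > 0" "padd (gyro_inv S padd f) ` nhd U \<epsilon> \<subseteq> W"
      using W unfolding nhd_open_def by blast
    obtain V where V: "V \<in> \<U>" "\<And>r v. r \<in> unit_J \<Longrightarrow> f r \<in> G \<Longrightarrow> v \<in> V \<Longrightarrow>
        inverse_of (inverse_of (f r)) \<oplus> inverse_of (f r \<oplus> v) \<in> U"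
    proof (rule uniform_nhd[OF f(1), where U = U and Y = G
          and \<phi> = "\<lambda>x v. inverse_of (inverse_of x) \<oplus> inverse_of (x \<oplus> v)"])
      show "continuous_map T T (\<lambda>v. inverse_of (inverse_of x) \<oplus> inverse_of (x \<oplus> v))"
        if "x \<in> G" for x
        using that by (intro continuous_map_gyro closed gyro_inv continuous_map_id[unfolded id_def])
      show "inverse_of (inverse_of x) \<oplus> inverse_of (x \<oplus> e) \<in> U" if "x \<in> G" for x
        using that base_nhd[OF U(1)] by (simp add: gyro_id_right gyro_inv)
    qed (use base_nhd[OF U(1)] in auto)
    have "gyro_inv S padd h \<in> W" if h: "h \<in> padd f ` nhd V \<epsilon>" for h
    proof -
      obtain p where p: "p \<in> nhd V \<epsilon>" "h = padd f p" using h by blast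
      have hS: "h \<in> S" using h translate_subset[OF f(1)] by blast
      have "(\<lambda>r\<in>unit_J. inverse_of (gyro_inv S padd f r) \<oplus> gyro_inv S padd h r) \<in> nhd U \<epsilon>"
        using V(2) step_functions_mem[OF f(1)]
        by (intro step_nhdI1[OF left_quotient_step p(1)] inv_S f hS)
          (auto simp: pointwise_inverse[OF hS] pointwise_inverse[OF f(1)], simp add: p(2) pointwise_add_def)
      then show ?thesis using U(3) mem_translate_step_nhdI inv_S f(1) hS by blast
    qed
    then show "\<exists>V\<in>\<U>. \<exists>\<epsilon>>0. padd f ` nhd V \<epsilon> \<subseteq> {f \<in> S. gyro_inv S padd f \<in> W}"
      using V(1) U(2) translate_subset[OF f(1)] by blast
  qed auto
qed

lemma step_topological_gyrogroup: "topological_gyrogroup S padd TS"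
  by (intro topological_gyrogroup.intro step_gyrogroup topological_gyrogroup_axioms.intro
      topspace_TS continuous_padd continuous_pinv)

section \<open>Separation of distinct step functions\<close>

lemma Hausdorff_TS:
  assumes "Hausdorff_space T"
  shows "Hausdorff_space TS"
  unfolding Hausdorff_space_def
proof (intro allI impI)
  fix f g assume "f \<in> topspace TS \<and> g \<in> topspace TS \<and> f \<noteq> g"
  then have f: "f \<in> S" and g: "g \<in> S" and ne: "f \<noteq> g" by (auto simp: topspace_TS)
  obtain r where r: "r \<in> unit_J" "f r \<noteq> g r" using step_functions_eqI[OF f g] ne by blast
  have G: "f r \<in> G" "g r \<in> G" using f g r step_functions_mem by blast+
  \<comment> \<open>Applied to the pair, right constancy keeps both functions at their values at
    \<open>r\<close> on one common interval.\<close>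
  obtain d where d: "r < d" "d \<le> 1" "\<And>s. s \<in> {r..<d} \<Longrightarrow>
      (\<lambda>r\<in>unit_J. (f r, g r)) s = (\<lambda>r\<in>unit_J. (f r, g r)) r"
    using step_functions_right_constant[OF step_functions_Pair[OF f g] r(1)] by blast
  obtain A B where AB: "openin T A" "openin T B" "f r \<in> A" "g r \<in> B" "disjnt A B"
    using assms G r(2) topspace_eq unfolding Hausdorff_space_def by metis
  have op: "openin T {v \<in> topspace T. x \<oplus> v \<in> C}" if "x \<in> G" "openin T C" for x C
    using that
    by (intro openin_continuous_map_preimage[where Y = T] continuous_map_gyro
        continuous_map_id[unfolded id_def])
  \<comment> \<open>A single \<open>V\<close> moves \<open>f r\<close> only inside \<open>A\<close>
    and \<open>g r\<close> only inside \<open>B\<close>.\<close>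
  obtain V where V: "V \<in> \<U>" "\<And>v. v \<in> V \<Longrightarrow> f r \<oplus> v \<in> A" "\<And>v. v \<in> V \<Longrightarrow> g r \<oplus> v \<in> B"
  proof -
    let ?O = "{v \<in> topspace T. f r \<oplus> v \<in> A} \<inter> {v \<in> topspace T. g r \<oplus> v \<in> B}"
    have "openin T ?O" using op AB(1,2) G by blast
    moreover have "e \<in> ?O" using AB(3,4) G gyro_id by (simp add: topspace_eq gyro_id_right)
    ultimately obtain V where "V \<in> \<U>" "V \<subseteq> ?O"
      using open_base unfolding open_base_at_def by blast
    then show thesis using that by blast
  qed
  \<comment> \<open>Half the length of the interval: at a common point of the two translates, the
    exceptional sets of \<open>p\<close> and \<open>q\<close> would cover the interval, although
    their measures add up to less than its length.\<close>
  define \<delta> where "\<delta> = (d - r) / 2"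
  have \<delta>: "\<delta> > 0" using d by (simp add: \<delta>_def)
  have "False" if "h \<in> padd f ` nhd V \<delta>" "h \<in> padd g ` nhd V \<delta>" for h
  proof -
    obtain p q where pq: "p \<in> nhd V \<delta>" "q \<in> nhd V \<delta>" "h = padd f p" "h = padd g q"
      using \<open>h \<in> padd f ` nhd V \<delta>\<close> \<open>h \<in> padd g ` nhd V \<delta>\<close> by blast
    then have S: "p \<in> S" "q \<in> S" by (auto simp: step_nhd_def)
    have "measure lebesgue {r..<d} \<le>
        measure lebesgue {r \<in> unit_J. p r \<notin> V} + measure lebesgue {r \<in> unit_J. q r \<notin> V}"
    proof (rule measure_step_functions_le[OF S])
      show J: "s \<in> unit_J" if "s \<in> {r..<d}" for s using that d(2) r(1) by auto
      fix s assume s: "s \<in> {r..<d}" "p s \<in> V" "q s \<in> V"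
      have "f s = f r" "g s = g r" using d(3)[OF s(1)] J[OF s(1)] r(1) by auto
      moreover have "h s = f s \<oplus> p s"
        unfolding pq(3) using J[OF s(1)] by (simp add: pointwise_add_def)
      moreover have "h s = g s \<oplus> q s"
        unfolding pq(4) using J[OF s(1)] by (simp add: pointwise_add_def)
      ultimately have "h s \<in> A" "h s \<in> B" using V(2)[OF s(2)] V(3)[OF s(3)] by simp_all
      then show False using AB(5) by (auto simp: disjnt_iff)
    qed auto
    also have "\<dots> < \<delta> + \<delta>" using pq(1,2) by (simp add: step_nhd_def)
    finally show False using d(1) by (simp add: \<delta>_def)
  qed
  then show "\<exists>A B. openin TS A \<and> openin TS B \<and> f \<in> A \<and> g \<in> B \<and> disjnt A B"
    using openin_translate translate_mem f g V(1) \<delta> by (meson disjnt_iff)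
qed

end

theorem theorem3p1:
  fixes G :: "'a set" and add :: "'a \<Rightarrow> 'a \<Rightarrow> 'a" and T :: "'a topology"
    and \<U> :: "'a set set"
  assumes "topological_gyrogroup G add T"
    and "Hausdorff_space T"
    and "open_base_at T (gyro_id G add) \<U>"
  shows "is_base_of_topology_on (step_functions G) (step_base G add \<U>) \<and>
    topological_gyrogroup (step_functions G) (pointwise_add add)
      (topology_of_base (step_base G add \<U>)) \<and>
    Hausdorff_space (topology_of_base (step_base G add \<U>))"
proof -
  interpret based_topological_gyrogroup G add T \<U>
    using assms by (simp add: based_topological_gyrogroup_def based_topological_gyrogroup_axioms_def)
  show ?thesis
    using step_base_is_base step_topological_gyrogroup Hausdorff_TS[OF assms(2)] by blast
qed

end
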